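(* Let $k\ge1$ be an integer, let $u:\mathbb{R}\to\mathbb{R}$ be a smooth function and let $f:\mathbb{R}\to\mathbb{R}^+$ be a smooth positive function. Then $u$ is $f$-$k$-harmonic if and only if it can be expressed as $$u(x)=\underbrace{\int\cdots\int}_{k\text{ times}}\frac{C_{k-1}x^{k-1}+\cdots+C_2x^2+C_1x+C_0}{f(x)}\,(dx)^k+D_{k-1}x^{k-1}+\cdots+D_2x^2+D_1x+D_0,$$ where $C_{k-1},\dots,C_0,D_{k-1},\dots,D_0$ are arbitrary real constants.
   Context: The $k$-fold integral denotes a $k$-th iterated antiderivative on $\mathbb{R}$ (e.g. obtained by integrating $k$ times from $0$). For a smooth positive $f$ on a Riemannian manifold, a smooth function $u$ is called $f$-$k$-harmonic if, with $s=\lfloor k/2\rfloor$ and $\Delta$ the Laplace–Beltrami operator, $$\Delta^s(f\,\Delta^s u)=0\ \text{ when } k=2s,\qquad \Delta^s\big(\operatorname{div}(f\nabla\Delta^s u)\big)=0\ \text{ when } k=2s+1 .$$ Here the manifold is $\mathbb{R}$ with its standard metric, so $\Delta u=u''$, $\nabla u=u'$ and $\operatorname{div}$ is $d/dx$. *)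

theory Defs
  imports "HOL-Analysis.Analysis"
begin

definition smooth :: "(real \<Rightarrow> real) \<Rightarrow> bool" where
  "smooth f \<longleftrightarrow> (\<forall>n x. (deriv ^^ n) f differentiable at x)"

text \<open>The differential operators of the Riemannian manifold \<open>\<real>\<close> with its standard metric, where
  vector fields are identified with real functions.\<close>

definition grad :: "(real \<Rightarrow> real) \<Rightarrow> real \<Rightarrow> real" where
  "grad u = deriv u"

definition divergence :: "(real \<Rightarrow> real) \<Rightarrow> real \<Rightarrow> real" where
  "divergence X = deriv X"

definition laplacian :: "(real \<Rightarrow> real) \<Rightarrow> real \<Rightarrow> real" where
  "laplacian u = divergence (grad u)"

definition f_k_harmonic :: "(real \<Rightarrow> real) \<Rightarrow> nat \<Rightarrow> (real \<Rightarrow> real) \<Rightarrow> bool" where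
  "f_k_harmonic f k u \<longleftrightarrow>
     smooth f \<and> (\<forall>x. f x > 0) \<and> smooth u \<and>
     (let s = k div 2 in
       if even k
       then \<forall>x. (laplacian ^^ s) (\<lambda>y. f y * (laplacian ^^ s) u y) x = 0
       else \<forall>x. (laplacian ^^ s) (divergence (\<lambda>y. f y * grad ((laplacian ^^ s) u) y)) x = 0)"

fun iterated_antiderivative :: "nat \<Rightarrow> (real \<Rightarrow> real) \<Rightarrow> (real \<Rightarrow> real) \<Rightarrow> bool" where
  "iterated_antiderivative 0 g F \<longleftrightarrow> F = g"
| "iterated_antiderivative (Suc k) g F \<longleftrightarrow>
     (\<exists>G. iterated_antiderivative k g G \<and> (\<forall>x. (F has_real_derivative G x) (at x)))"

text \<open>The \<open>k\<close>-fold integral sign denotes some choice, for every continuous integrand, of a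
  \<open>k\<close>-th iterated antiderivative; no particular choice is singled out. Iterating \<open>k\<close> times the
  integration from \<open>0\<close> is one such choice, see \<open>k_fold_integral_from_0\<close> below.\<close>

definition k_fold_integral :: "nat \<Rightarrow> ((real \<Rightarrow> real) \<Rightarrow> real \<Rightarrow> real) \<Rightarrow> bool" where
  "k_fold_integral k J \<longleftrightarrow>
     (\<forall>g. continuous_on UNIV g \<longrightarrow> iterated_antiderivative k g (J g))"

definition integral_from_0 :: "(real \<Rightarrow> real) \<Rightarrow> real \<Rightarrow> real" where
  "integral_from_0 g x = (LBINT t=0..x. g t)"

lemma integral_from_0_has_derivative:
  assumes "continuous_on UNIV g"
  shows "(integral_from_0 g has_real_derivative g x) (at x)"
proof -
  define a b where "a = min 0 x - 1" and "b = max 0 x + 1"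
  have ab: "a < 0" "0 < b" "a < x" "x < b" by (auto simp: a_def b_def)
  have "((\<lambda>v. LBINT t=ereal 0..ereal v. g t) has_vector_derivative g x) (at x within {a..b})"
    using ab assms
    by (intro interval_integral_FTC2) (auto intro: continuous_on_subset)
  moreover have "at x within {a..b} = at x"
    using ab by (intro at_within_interior) auto
  ultimately show ?thesis
    by (simp add: has_real_derivative_iff_has_vector_derivative integral_from_0_def[abs_def]
        zero_ereal_def)
qed

lemma k_fold_integral_from_0: "k_fold_integral k (integral_from_0 ^^ k)"
proof -
  have "iterated_antiderivative k g ((integral_from_0 ^^ k) g) \<and>
        continuous_on UNIV ((integral_from_0 ^^ k) g)"
    if "continuous_on UNIV g" for g
  proof (induction k)
    case 0
    then show ?case using that by simp
  next
    case (Suc k)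
    then have "\<forall>x. ((integral_from_0 ^^ Suc k) g has_real_derivative
                    (integral_from_0 ^^ k) g x) (at x)"
      by (simp add: integral_from_0_has_derivative)
    moreover from this have "continuous_on UNIV ((integral_from_0 ^^ Suc k) g)"
      by (meson DERIV_isCont continuous_at_imp_continuous_on)
    ultimately show ?case using Suc by auto
  qed
  then show ?thesis by (simp add: k_fold_integral_def)
qed

end

theory Submission
  imports Defs
begin

text \<open>On the line, \<open>f\<close>-\<open>k\<close>-harmonicity of \<open>u\<close> says that the \<open>k\<close>-th derivative of
  \<open>f u\<^sup>(\<^sup>k\<^sup>)\<close> vanishes, whatever the parity of \<open>k\<close>. Equivalently \<open>f u\<^sup>(\<^sup>k\<^sup>) = P\<close> for a polynomial
  \<open>P\<close> of degree less than \<open>k\<close>, that is, \<open>u\<close> is a \<open>k\<close>-th antiderivative of \<open>P / f\<close>; two such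
  antiderivatives differ by a polynomial of degree less than \<open>k\<close>.\<close>

lemma iterated_antiderivative_add:
  assumes "iterated_antiderivative k g F" "iterated_antiderivative k h G"
  shows "iterated_antiderivative k (\<lambda>x. g x + h x) (\<lambda>x. F x + G x)"
  using assms
proof (induction k arbitrary: F G)
  case (Suc k)
  then obtain F' G' where
    "iterated_antiderivative k g F'" "\<forall>x. (F has_real_derivative F' x) (at x)"
    "iterated_antiderivative k h G'" "\<forall>x. (G has_real_derivative G' x) (at x)"
    by auto
  with Suc.IH show ?case
    by (auto intro!: exI[of _ "\<lambda>x. F' x + G' x"] DERIV_add)
qed simp

lemma iterated_antiderivative_diff:
  assumes "iterated_antiderivative k g F" "iterated_antiderivative k h G"
  shows "iterated_antiderivative k (\<lambda>x. g x - h x) (\<lambda>x. F x - G x)"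
  using assms
proof (induction k arbitrary: F G)
  case (Suc k)
  then obtain F' G' where
    "iterated_antiderivative k g F'" "\<forall>x. (F has_real_derivative F' x) (at x)"
    "iterated_antiderivative k h G'" "\<forall>x. (G has_real_derivative G' x) (at x)"
    by auto
  with Suc.IH show ?case
    by (auto intro!: exI[of _ "\<lambda>x. F' x - G' x"] DERIV_diff)
qed simp

lemma iterated_antiderivative_imp_deriv:
  assumes "iterated_antiderivative k g F"
  shows "(deriv ^^ k) F = g"
  using assms
proof (induction k arbitrary: F)
  case (Suc k)
  then obtain G where G: "iterated_antiderivative k g G" "\<forall>x. (F has_real_derivative G x) (at x)"
    by auto
  then have "deriv F = G"
    by (auto intro: DERIV_imp_deriv)
  with Suc.IH[OF G(1)] show ?case
    by (simp only: funpow_Suc_right o_apply)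
qed simp

lemma smooth_deriv:
  assumes "smooth f"
  shows "smooth (deriv f)"
  unfolding smooth_def
proof (intro allI)
  fix n x
  have "(deriv ^^ Suc n) f differentiable at x"
    using assms unfolding smooth_def by blast
  then show "(deriv ^^ n) (deriv f) differentiable at x"
    by (simp only: funpow_Suc_right o_apply)
qed

lemma smooth_funpow_deriv: "smooth f \<Longrightarrow> smooth ((deriv ^^ n) f)"
  by (induction n) (auto intro: smooth_deriv)

lemma smooth_has_deriv:
  assumes "smooth f"
  shows "(f has_real_derivative deriv f x) (at x)"
proof -
  have "(deriv ^^ 0) f differentiable at x"
    using assms unfolding smooth_def by blast
  then show ?thesis
    by (auto simp: real_differentiable_def dest: DERIV_imp_deriv)
qed

lemma smooth_iterated_antiderivative:
  assumes "smooth F"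
  shows "iterated_antiderivative k ((deriv ^^ k) F) F"
  using assms
proof (induction k arbitrary: F)
  case (Suc k)
  then have "iterated_antiderivative k ((deriv ^^ Suc k) F) (deriv F)"
    using smooth_deriv[of F] by (simp only: funpow_Suc_right o_apply)
  then show ?case
    using smooth_has_deriv[OF Suc.prems] iterated_antiderivative.simps(2) by blast
qed simp

text \<open>\<open>deriv\<close> is a total function, so an equation between iterated
  \<open>deriv\<close> does not by itself assert differentiability. Smoothness of \<open>F\<close>
  supplies it, and the two ways of speaking about \<open>k\<close>-th derivatives become
  interchangeable.\<close>

lemma smooth_iterated_antiderivative_iff:
  "smooth F \<Longrightarrow> iterated_antiderivative k g F \<longleftrightarrow> (deriv ^^ k) F = g"
  using smooth_iterated_antiderivative iterated_antiderivative_imp_deriv by blast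

text \<open>The relation carries the existence of all intermediate derivatives, so smoothness can be
  shown without a formula for the \<open>n\<close>-th derivative.\<close>

lemma smoothI_iterated_antiderivative:
  assumes "\<And>k. \<exists>g. iterated_antiderivative k g F"
  shows "smooth F"
  unfolding smooth_def
proof (intro allI)
  fix n x
  \<comment> \<open>Differentiability of the \<open>n\<close>-th derivative takes one derivative
    more, hence order \<open>Suc n\<close>.\<close>
  obtain g where "iterated_antiderivative (Suc n) g F"
    using assms by blast
  then have "(deriv ^^ n) F differentiable at x"
  proof (induction n arbitrary: F)
    case 0
    then show ?case by (auto simp: real_differentiable_def)
  next
    case (Suc n)
    then obtain G where G: "iterated_antiderivative (Suc n) g G"
      "\<forall>x. (F has_real_derivative G x) (at x)"
      \<comment> \<open>Only the outer \<open>Suc\<close> is unfolded: the induction hypothesis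
        needs order \<open>Suc n\<close> for \<open>G\<close>.\<close>
      by (subst (asm) iterated_antiderivative.simps(2)) blast
    then have "deriv F = G"
      by (auto intro: DERIV_imp_deriv)
    with Suc.IH[OF G(1)] show ?case
      by (simp only: funpow_Suc_right o_apply)
  qed
  then show "(deriv ^^ n) F differentiable at x" .
qed

text \<open>The product rule gives a sum of two products of smooth functions, so induction on the
  order, with both factors arbitrary, replaces the general Leibniz formula.\<close>

lemma smooth_mult:
  assumes "smooth f" "smooth g"
  shows "smooth (\<lambda>x. f x * g x)"
proof (rule smoothI_iterated_antiderivative)
  fix k
  show "\<exists>h. iterated_antiderivative k h (\<lambda>x. f x * g x)"
    using assms
  proof (induction k arbitrary: f g)
    case (Suc k)
    obtain h1 h2 where
      "iterated_antiderivative k h1 (\<lambda>x. deriv f x * g x)"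
      "iterated_antiderivative k h2 (\<lambda>x. f x * deriv g x)"
      using Suc smooth_deriv by meson
    then have "iterated_antiderivative k (\<lambda>x. h1 x + h2 x) (\<lambda>x. deriv f x * g x + f x * deriv g x)"
      by (rule iterated_antiderivative_add)
    moreover have "((\<lambda>x. f x * g x) has_real_derivative deriv f x * g x + f x * deriv g x) (at x)" for x
      using Suc.prems
      by (auto intro!: derivative_eq_intros smooth_has_deriv simp: algebra_simps)
    ultimately show ?case by auto
  qed simp
qed

text \<open>The kernel of the \<open>k\<close>-th derivative: each integration raises the degree
  bound by one and adds one free constant.\<close>

lemma iterated_antiderivative_zero_iff:
  "iterated_antiderivative k (\<lambda>x. 0) F \<longleftrightarrow> (\<exists>C. \<forall>x. F x = (\<Sum>i<k. C i * x ^ i))"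
proof (induction k arbitrary: F)
  case 0
  then show ?case by auto
next
  case (Suc k)
  show ?case
  proof
    assume "iterated_antiderivative (Suc k) (\<lambda>x. 0) F"
    then obtain G where G: "iterated_antiderivative k (\<lambda>x. 0) G"
      "\<And>x. (F has_real_derivative G x) (at x)"
      by auto
    then obtain C where "\<And>x. G x = (\<Sum>i<k. C i * x ^ i)"
      using Suc.IH by blast
    with G(2) have C: "(F has_real_derivative (\<Sum>i<k. C i * x ^ i)) (at x)" for x
      by metis
    \<comment> \<open>Subtracting the termwise primitive of \<open>G\<close> leaves zero derivative,
      hence a constant.\<close>
    have "((\<lambda>x. F x - (\<Sum>i<k. C i / real (Suc i) * x ^ Suc i)) has_real_derivative 0) (at x)" for x
    proof -
      have "((\<lambda>x. \<Sum>i<k. C i / real (Suc i) * x ^ Suc i) has_real_derivative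
              (\<Sum>i<k. C i / real (Suc i) * (real (Suc i) * x ^ i))) (at x)"
        by (intro DERIV_sum DERIV_cmult DERIV_pow[THEN DERIV_cong]) simp
      also have "(\<Sum>i<k. C i / real (Suc i) * (real (Suc i) * x ^ i)) = (\<Sum>i<k. C i * x ^ i)"
        by (intro sum.cong) (auto simp del: of_nat_Suc)
      finally show ?thesis
        using DERIV_diff[OF C] by fastforce
    qed
    then obtain c where c: "\<And>x. F x - (\<Sum>i<k. C i / real (Suc i) * x ^ Suc i) = c"
      using DERIV_isconst_all by blast
    \<comment> \<open>The integration constant \<open>c\<close> becomes coefficient 0; the others
      move up one index.\<close>
    have "F x = (\<Sum>i<Suc k. (case i of 0 \<Rightarrow> c | Suc j \<Rightarrow> C j / real (Suc j)) * x ^ i)" for x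
      using c[of x] by (subst sum.lessThan_Suc_shift) simp
    then show "\<exists>C. \<forall>x. F x = (\<Sum>i<Suc k. C i * x ^ i)"
      by blast
  next
    assume "\<exists>C. \<forall>x. F x = (\<Sum>i<Suc k. C i * x ^ i)"
    then obtain C where "\<And>x. F x = (\<Sum>i<Suc k. C i * x ^ i)" by blast
    then have F: "F = (\<lambda>x. C 0 + (\<Sum>i<k. C (Suc i) * x ^ Suc i))"
      by (subst (asm) sum.lessThan_Suc_shift) auto
    define G where "G x = (\<Sum>i<k. (C (Suc i) * real (Suc i)) * x ^ i)" for x
    have "(F has_real_derivative 0 + (\<Sum>i<k. C (Suc i) * (real (Suc i) * x ^ i))) (at x)" for x
      unfolding F
      by (intro DERIV_add DERIV_const DERIV_sum DERIV_cmult DERIV_pow[THEN DERIV_cong]) simp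
    then have "(F has_real_derivative G x) (at x)" for x
      by (simp add: G_def mult.assoc)
    moreover have "iterated_antiderivative k (\<lambda>x. 0) G"
      unfolding Suc.IH by (rule exI[of _ "\<lambda>i. C (Suc i) * real (Suc i)"]) (simp add: G_def)
    ultimately show "iterated_antiderivative (Suc k) (\<lambda>x. 0) F"
      by auto
  qed
qed

lemma funpow_laplacian: "laplacian ^^ s = deriv ^^ (2 * s)"
proof (induction s)
  case (Suc s)
  then show ?case
    by (simp add: comp_def laplacian_def[abs_def] grad_def[abs_def] divergence_def[abs_def])
qed simp

text \<open>Inside and outside, \<open>s\<close> Laplacians give \<open>2 * s\<close> derivatives;
  for odd \<open>k\<close>, \<open>grad\<close> and \<open>divergence\<close> contribute the missing
  one on each side.\<close>

lemma f_k_harmonic_iff: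
  "f_k_harmonic f k u \<longleftrightarrow> smooth f \<and> (\<forall>x. f x > 0) \<and> smooth u \<and>
     (\<forall>x. (deriv ^^ k) (\<lambda>y. f y * (deriv ^^ k) u y) x = 0)"
proof (cases "even k")
  case True
  then show ?thesis
    by (simp add: f_k_harmonic_def funpow_laplacian)
next
  case False
  then obtain s where s: "k = Suc (2 * s)"
    by (metis oddE Suc_eq_plus1)
  \<comment> \<open>The extra derivative comes first in the outer operator
    (\<open>divergence\<close>) but last in the inner one (\<open>grad\<close>), so
    \<open>deriv ^^ k\<close> is split at opposite ends.\<close>
  have "(deriv ^^ k) h = (deriv ^^ (2 * s)) (deriv h)" for h :: "real \<Rightarrow> real"
    by (simp only: s funpow_Suc_right o_apply)
  moreover have "(deriv ^^ k) u = deriv ((deriv ^^ (2 * s)) u)"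
    by (simp add: s)
  moreover have "k div 2 = s"
    by (simp add: s)
  ultimately show ?thesis
    using False by (simp add: f_k_harmonic_def funpow_laplacian grad_def divergence_def)
qed

lemma f_k_harmonic_iff_polynomial:
  assumes "smooth u" "smooth f" "\<And>x. f x > 0"
  shows "f_k_harmonic f k u \<longleftrightarrow>
    (\<exists>C. iterated_antiderivative k (\<lambda>t. (\<Sum>i<k. C i * t ^ i) / f t) u)"
proof -
  define g where "g y = f y * (deriv ^^ k) u y" for y
  have "smooth g"
    unfolding g_def using assms by (intro smooth_mult smooth_funpow_deriv)
  have "f_k_harmonic f k u \<longleftrightarrow> (deriv ^^ k) g = (\<lambda>x. 0)"
    using assms by (auto simp: f_k_harmonic_iff g_def[abs_def])
  also have "\<dots> \<longleftrightarrow> iterated_antiderivative k (\<lambda>x. 0) g"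
    by (simp only: smooth_iterated_antiderivative_iff[OF \<open>smooth g\<close>])
  also have "\<dots> \<longleftrightarrow> (\<exists>C. \<forall>x. g x = (\<Sum>i<k. C i * x ^ i))"
    by (rule iterated_antiderivative_zero_iff)
  \<comment> \<open>Positivity of \<open>f\<close> allows division.\<close>
  also have "\<dots> \<longleftrightarrow> (\<exists>C. (deriv ^^ k) u = (\<lambda>t. (\<Sum>i<k. C i * t ^ i) / f t))"
    by (simp add: g_def fun_eq_iff eq_divide_eq mult.commute less_imp_neq[OF assms(3), symmetric])
  also have "\<dots> \<longleftrightarrow> (\<exists>C. iterated_antiderivative k (\<lambda>t. (\<Sum>i<k. C i * t ^ i) / f t) u)"
    by (simp only: smooth_iterated_antiderivative_iff[OF assms(1)])
  finally show ?thesis .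
qed

text \<open>By linearity, the \<open>k\<close>-th antiderivatives of \<open>g\<close> form a coset
  of the kernel.\<close>

lemma iterated_antiderivative_iff_diff_polynomial:
  assumes "iterated_antiderivative k g F"
  shows "iterated_antiderivative k g u \<longleftrightarrow> (\<exists>D. \<forall>x. u x = F x + (\<Sum>i<k. D i * x ^ i))"
proof -
  have "iterated_antiderivative k g u \<longleftrightarrow> iterated_antiderivative k (\<lambda>x. 0) (\<lambda>x. u x - F x)"
    using iterated_antiderivative_diff[OF _ assms, of g u]
      iterated_antiderivative_add[OF assms, of "\<lambda>x. 0" "\<lambda>x. u x - F x"]
    by auto
  then show ?thesis
    by (simp add: iterated_antiderivative_zero_iff diff_eq_eq add.commute)
qed

theorem corollary6p4:
  fixes k :: nat and u f :: "real \<Rightarrow> real"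
    and J :: "(real \<Rightarrow> real) \<Rightarrow> real \<Rightarrow> real"
  assumes "k \<ge> 1"
    and "smooth u"
    and "smooth f" and "\<And>x. f x > 0"
    and "k_fold_integral k J"
  shows "f_k_harmonic f k u \<longleftrightarrow>
    (\<exists>C D :: nat \<Rightarrow> real. \<forall>x.
       u x = J (\<lambda>t. (\<Sum>i<k. C i * t ^ i) / f t) x + (\<Sum>i<k. D i * x ^ i))"
proof -
  have "continuous_on UNIV f"
    using smooth_has_deriv[OF assms(3)]
    by (meson DERIV_isCont continuous_at_imp_continuous_on)
  \<comment> \<open>\<open>J\<close> is specified only on continuous integrands.\<close>
  then have "continuous_on UNIV (\<lambda>t. (\<Sum>i<k. C i * t ^ i) / f t)" for C
    by (intro continuous_intros) (simp_all add: less_imp_neq[OF assms(4), symmetric])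
  then have "iterated_antiderivative k (\<lambda>t. (\<Sum>i<k. C i * t ^ i) / f t)
      (J (\<lambda>t. (\<Sum>i<k. C i * t ^ i) / f t))" for C
    using assms(5) unfolding k_fold_integral_def by blast
  \<comment> \<open>For each fixed \<open>C\<close>, the value of \<open>J\<close> serves as the
    reference antiderivative, and \<open>D\<close> absorbs the choice made by
    \<open>J\<close>.\<close>
  note iterated_antiderivative_iff_diff_polynomial[OF this]
  then show ?thesis
    by (simp add: f_k_harmonic_iff_polynomial[OF assms(2-4)])
qed

end
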